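(* Let $\Psi:X\rightrightarrows Y$ be a set-valued mapping between metric spaces. (i) If $\Psi$ is set-covering on $X$ with constant $\alpha>0$, then $$\operatorname{dist}\bigl(x,\Psi^{-\sharp}(S)\bigr)\le\frac{1}{\alpha}\operatorname{exc}\bigl(S,\Psi(x)\bigr),\qquad\forall x\in X,\ \forall S\in 2^Y.\qquad(\ast)$$ (ii) If, for some $\alpha>0$, inequality $(\ast)$ holds, then $\Psi$ is set-covering on $X$ with any constant $\tilde\alpha\in(0,\alpha)$.
   Context: Conventions: $\Psi$ is assumed to have nonempty closed values at every point of $X$. In a metric space, $\mathrm{B}(x,r)$ is the closed ball of center $x$ and radius $r$; $\operatorname{dist}(x,S)=\inf_{z\in S}d(z,x)$, with $\operatorname{dist}(x,\varnothing)=+\infty$; $\mathrm{B}(S,r)=\{x:\operatorname{dist}(x,S)\le r\}$; the excess of $A$ over $B$ is $\operatorname{exc}(A,B)=\sup_{a\in A}\operatorname{dist}(a,B)\in[0,+\infty]$ (with $\operatorname{exc}(\varnothing,B)=0$). $\Psi$ is set-covering on $X$ with constant $\alpha>0$ if for every $x\in X$ and every $r>0$ there exists $u\in \mathrm{B}(x,r)$ such that $\mathrm{B}(\Psi(x),\alpha r)\subseteq\Psi(u)$. $2^Y$ is the collection of all subsets of $Y$, and $\Psi^{-\sharp}:2^Y\rightrightarrows X$ is defined by $\Psi^{-\sharp}(S)=\{x\in X: S\subseteq\Psi(x)\}$ (possibly empty). *)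

theory Defs
  imports "HOL-Analysis.Analysis"
begin

text \<open>
  Distances and excesses take values in \<open>[0, \<infinity>]\<close>, so that the infimum over the empty set is
  \<open>\<infinity>\<close> and the supremum over the empty set is \<open>0\<close>.  The library function \<^const>\<open>infdist\<close>
  is not suitable, since it is real-valued with value \<open>0\<close> on the empty set.
\<close>

definition set_dist :: "'a::metric_space \<Rightarrow> 'a set \<Rightarrow> ennreal" where
  "set_dist x S = (INF z\<in>S. ennreal (dist z x))"

definition excess :: "'a::metric_space set \<Rightarrow> 'a set \<Rightarrow> ennreal" where
  "excess A B = (SUP a\<in>A. set_dist a B)"

text \<open>Only meant for \<open>r \<ge> 0\<close>: \<^const>\<open>ennreal\<close> sends negative reals to \<open>0\<close>.\<close>

definition enlargement :: "'a::metric_space set \<Rightarrow> real \<Rightarrow> 'a set" where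
  "enlargement S r = {x. set_dist x S \<le> ennreal r}"

definition set_covering :: "('a::metric_space \<Rightarrow> 'b::metric_space set) \<Rightarrow> real \<Rightarrow> bool" where
  "set_covering \<Psi> \<alpha> \<longleftrightarrow>
     \<alpha> > 0 \<and> (\<forall>x. \<forall>r>0. \<exists>u\<in>cball x r. enlargement (\<Psi> x) (\<alpha> * r) \<subseteq> \<Psi> u)"

definition sharp_inverse :: "('a \<Rightarrow> 'b set) \<Rightarrow> 'b set \<Rightarrow> 'a set" where
  "sharp_inverse \<Psi> S = {x. S \<subseteq> \<Psi> x}"

end

theory Submission
  imports Defs
begin

text \<open>
  An inclusion \<open>S \<subseteq> \<Psi> u\<close> with \<open>u\<close> near \<open>x\<close> is the same as a point of
  \<open>sharp_inverse \<Psi> S\<close> near \<open>x\<close>, and \<open>S \<subseteq> enlargement (\<Psi> x) r\<close> is the same as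
  \<open>excess S (\<Psi> x) \<le> r\<close>.  For the distance estimate, apply set-covering with every radius
  \<open>r > excess S (\<Psi> x) / \<alpha>\<close> and let \<open>r\<close> decrease to this bound; an infinite excess is
  trivial.  Conversely, apply the distance estimate to \<open>S = enlargement (\<Psi> x) (\<beta> * r)\<close>: it
  gives a distance of at most \<open>\<beta> * r / \<alpha> < r\<close>, and the strict inequality compensates for the
  infimum possibly not being attained.
\<close>

lemma excess_le_iff: "excess S T \<le> ennreal r \<longleftrightarrow> S \<subseteq> enlargement T r"
  by (auto simp: excess_def enlargement_def SUP_le_iff)

lemma set_dist_le_dist:
  assumes "z \<in> S"
  shows "set_dist x S \<le> ennreal (dist z x)"
  unfolding set_dist_def using assms by (rule INF_lower)

lemma set_dist_lessE:
  assumes "set_dist x S < ennreal r"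
  obtains z where "z \<in> S" "dist z x < r"
proof -
  from assms obtain z where "z \<in> S" "ennreal (dist z x) < ennreal r"
    unfolding set_dist_def INF_less_iff by blast
  then show thesis
    using that by (simp add: ennreal_less_iff)
qed

lemma set_covering_imp_set_dist_le:
  assumes "set_covering \<Psi> \<alpha>"
  shows "set_dist x (sharp_inverse \<Psi> S) \<le> ennreal (1 / \<alpha>) * excess S (\<Psi> x)"
proof (cases "excess S (\<Psi> x)" rule: ennreal_cases)
  case (real e)
  have "\<alpha> > 0"
    using assms by (simp add: set_covering_def)
  show ?thesis
  proof (rule ennreal_le_epsilon)
    fix \<delta> :: real
    assume "\<delta> > 0"
    \<comment> \<open>The slack \<open>\<delta>\<close> also keeps the radius positive when the excess vanishes.\<close>
    define r where "r = e / \<alpha> + \<delta>"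
    have "r > 0"
      using \<open>\<alpha> > 0\<close> \<open>\<delta> > 0\<close> \<open>0 \<le> e\<close> by (simp add: r_def add_nonneg_pos)
    then obtain u where u: "dist u x \<le> r" "enlargement (\<Psi> x) (\<alpha> * r) \<subseteq> \<Psi> u"
      using assms unfolding set_covering_def by (metis dist_commute mem_cball)
    have "e \<le> \<alpha> * r"
      using \<open>\<alpha> > 0\<close> \<open>\<delta> > 0\<close> by (simp add: r_def distrib_left)
    then have "S \<subseteq> enlargement (\<Psi> x) (\<alpha> * r)"
      using real by (simp add: ennreal_leI flip: excess_le_iff)
    then have "u \<in> sharp_inverse \<Psi> S"
      using u(2) by (auto simp: sharp_inverse_def)
    then have "set_dist x (sharp_inverse \<Psi> S) \<le> ennreal (dist u x)"
      by (rule set_dist_le_dist)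
    also have "\<dots> \<le> ennreal r"
      using u(1) by (rule ennreal_leI)
    also have "\<dots> = ennreal (1 / \<alpha>) * excess S (\<Psi> x) + ennreal \<delta>"
      using \<open>\<alpha> > 0\<close> \<open>\<delta> > 0\<close> real by (simp add: r_def flip: ennreal_mult ennreal_plus)
    finally show "set_dist x (sharp_inverse \<Psi> S)
        \<le> ennreal (1 / \<alpha>) * excess S (\<Psi> x) + ennreal \<delta>" .
  qed
next
  case top
  then show ?thesis
    using assms by (simp add: set_covering_def ennreal_mult_top)
qed

lemma set_covering_if_set_dist_le:
  assumes le: "\<And>x S. set_dist x (sharp_inverse \<Psi> S) \<le> ennreal (1 / \<alpha>) * excess S (\<Psi> x)"
    and "0 < \<beta>" "\<beta> < \<alpha>"
  shows "set_covering \<Psi> \<beta>"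
  unfolding set_covering_def
proof (intro conjI allI impI)
  fix x and r :: real
  assume "r > 0"
  let ?S = "enlargement (\<Psi> x) (\<beta> * r)"
  have "set_dist x (sharp_inverse \<Psi> ?S) \<le> ennreal (1 / \<alpha>) * excess ?S (\<Psi> x)"
    by (rule le)
  also have "\<dots> \<le> ennreal (1 / \<alpha>) * ennreal (\<beta> * r)"
    by (intro mult_left_mono) (simp_all add: excess_le_iff)
  also have "\<dots> = ennreal (\<beta> * r / \<alpha>)"
    using assms(2,3) \<open>r > 0\<close> by (simp flip: ennreal_mult)
  also have "\<dots> < ennreal r"
    using assms(2,3) \<open>r > 0\<close> by (intro ennreal_lessI) (simp_all add: divide_less_eq mult.commute)
  finally obtain u where "u \<in> sharp_inverse \<Psi> ?S" "dist u x < r"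
    by (rule set_dist_lessE)
  then show "\<exists>u\<in>cball x r. ?S \<subseteq> \<Psi> u"
    by (auto simp: sharp_inverse_def dist_commute intro!: bexI[of _ u])
qed (fact \<open>0 < \<beta>\<close>)

theorem proposition2p9:
  fixes \<Psi> :: "'a::metric_space \<Rightarrow> 'b::metric_space set"
  assumes "\<And>x. \<Psi> x \<noteq> {}" and "\<And>x. closed (\<Psi> x)"
  shows "(\<forall>\<alpha>>0. set_covering \<Psi> \<alpha> \<longrightarrow>
            (\<forall>x S. set_dist x (sharp_inverse \<Psi> S) \<le> ennreal (1 / \<alpha>) * excess S (\<Psi> x)))
       \<and> (\<forall>\<alpha>>0. (\<forall>x S. set_dist x (sharp_inverse \<Psi> S) \<le> ennreal (1 / \<alpha>) * excess S (\<Psi> x)) \<longrightarrow>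
            (\<forall>\<beta>. 0 < \<beta> \<and> \<beta> < \<alpha> \<longrightarrow> set_covering \<Psi> \<beta>))"
  using set_covering_imp_set_dist_le set_covering_if_set_dist_le by blast

end
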